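(* Let $p\equiv 1 \pmod 6$ be a prime and let $a$ be an integer with $p\nmid a$. The number of points $(x,y)$ on the curve $y^{2}=x^{3}+a^{3}$ modulo $p$ (counting the point at infinity) is given by $$4+\sum_{x\in\mathbb{F}_p}\rho(x),\qquad\text{where}\quad \rho(x)=\begin{cases}2 & \text{if } \chi(x^{3}+a^{3})=1,\\ 0 & \text{if } \chi(x^{3}+a^{3})\neq 1.\end{cases}$$ Also, the sum of such $y$ (the ordinates of the points $(x,y)$ on the curve) is $p$.
   Context: $\chi(u)=\left(\frac{u}{p}\right)$ is the Legendre symbol modulo $p$: it equals $+1$ if $u$ is a nonzero quadratic residue modulo $p$, $-1$ if $u$ is a quadratic non-residue, and $0$ if $p\mid u$. The points on the curve modulo $p$ are the pairs $(x,y)\in\mathbb{F}_p\times\mathbb{F}_p$ with $y^2=x^3+a^3$, together with one point at infinity.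
   Formalization: The sum of all ordinates, as integers in 0..p-1, need not be p (p=7, a=1 gives 28); proved instead: for each x with χ(x³+a³)=1 the ordinates y over that x sum to exactly p, and the sum of the ordinates of all points is congruent to p (that is, 0) modulo p. *)

theory Defs
  imports "HOL-Number_Theory.Number_Theory"
begin

text \<open>
  The field with \<open>p\<close> elements is represented by the least non-negative residues \<open>{0..<p}\<close>, the
  carrier of \<open>residue_ring p\<close>, with equations read as congruences. The ordinates are thereby
  integers, so that their integer sum makes sense.
\<close>

datatype point = Infinity | Affine int int

definition curve_points :: "int \<Rightarrow> int \<Rightarrow> point set" where
  "curve_points p a =
     insert Infinity {Affine x y | x y. x \<in> {0..<p} \<and> y \<in> {0..<p} \<and> [y^2 = x^3 + a^3] (mod p)}"

definition rho :: "int \<Rightarrow> int \<Rightarrow> int \<Rightarrow> nat" where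
  "rho p a x = (if Legendre (x^3 + a^3) p = 1 then 2 else 0)"

end

theory Submission
  imports Defs
begin

text \<open>
  Count the points column by column. Over an abscissa \<open>x\<close> the ordinates are the square roots of
  \<open>c = x\<^sup>3 + a\<^sup>3\<close> modulo \<open>p\<close>: there are two of them, \<open>y\<close> and \<open>p - y\<close>, when \<open>\<chi>(c) = 1\<close>, only \<open>0\<close> when
  \<open>p\<close> divides \<open>c\<close>, and none when \<open>\<chi>(c) = -1\<close> (\<open>square_roots_eq_pair\<close> and its companions). So
  \<open>\<rho>(x)\<close> accounts for every affine point except those of ordinate \<open>0\<close>, and the constant \<open>4\<close> is the
  point at infinity together with the three points of ordinate \<open>0\<close>.

  There are exactly three of these because \<open>p \<equiv> 1\<close> modulo \<open>3\<close>: the residues then contain a primitive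
  cube root of unity \<open>w\<close>, so that \<open>x\<^sup>3 + a\<^sup>3 \<equiv> (x + a) (x + a w) (x + a w\<^sup>2)\<close>, and the three
  roots are distinct since \<open>p\<close> does not divide \<open>a\<close> (\<open>card_roots_sum_of_cubes\<close>).

  The statements about ordinates come from the pairing of \<open>y\<close> with \<open>p - y\<close>: a column with
  \<open>\<chi>(c) = 1\<close> has ordinate sum exactly \<open>p\<close>, and the other columns have ordinate sum \<open>0\<close>. Hence the
  sum over the whole curve is a multiple of \<open>p\<close>.
\<close>

section \<open>Square roots modulo a prime\<close>

definition square_roots :: "int \<Rightarrow> int \<Rightarrow> int set" where
  "square_roots p c = {y \<in> {0..<p}. [y\<^sup>2 = c] (mod p)}"

lemma finite_square_roots [simp]: "finite (square_roots p c)"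
  by (rule finite_subset[of _ "{0..<p}"]) (auto simp: square_roots_def)

lemma residue_dvd_imp_eq_zero:
  fixes p y :: int
  assumes "y \<in> {0..<p}" and "p dvd y"
  shows "y = 0"
  using assms by (metis atLeastLessThan_iff dvd_imp_mod_0 mod_pos_pos_trivial)

text \<open>
  A root \<open>v\<close> satisfies \<open>v\<^sup>2 \<equiv> y\<^sup>2\<close>, and \<open>p\<close>, being prime, divides \<open>v - y\<close> or \<open>v + y\<close>. The two
  roots have the representatives \<open>y\<close> and \<open>p - y\<close> because \<open>y\<close> is not \<open>0\<close>, and they differ because
  \<open>p\<close> is odd.
\<close>
lemma square_roots_eq_pair:
  fixes p c :: int
  assumes p: "prime p" "p > 2" and c: "Legendre c p = 1"
  obtains y where "square_roots p c = {y, p - y}" and "y \<noteq> p - y"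
proof -
  from c have c0: "\<not> p dvd c" and "QuadRes p c"
    by (auto simp: Legendre_def cong_0_iff split: if_splits)
  then obtain z where z: "[z\<^sup>2 = c] (mod p)"
    by (auto simp: QuadRes_def)
  define y where "y = z mod p"
  have y: "y \<in> {0..<p}" "[y\<^sup>2 = c] (mod p)"
    using p z by (auto simp: y_def cong_def power_mod)
  have dvd: "p dvd y\<^sup>2 - c"
    using y(2) by (simp add: cong_iff_dvd_diff)
  have "y \<noteq> 0"
    using dvd c0 by auto
  have diff: "(p - y)\<^sup>2 - c = p * (p - 2 * y) + (y\<^sup>2 - c)"
    by (simp add: power2_eq_square algebra_simps)
  have "p dvd (p - y)\<^sup>2 - c"
    unfolding diff using dvd by (intro dvd_add) simp_all
  then have py: "[(p - y)\<^sup>2 = c] (mod p)"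
    by (simp add: cong_iff_dvd_diff)
  have "v = y \<or> v = p - y" if v: "v \<in> square_roots p c" for v
  proof -
    have "[v\<^sup>2 = y\<^sup>2] (mod p)"
      using v y(2) by (simp add: square_roots_def cong_def)
    then have "p dvd v\<^sup>2 - y\<^sup>2"
      by (simp add: cong_iff_dvd_diff)
    moreover have "v\<^sup>2 - y\<^sup>2 = (v - y) * (v + y)"
      by (simp add: power2_eq_square algebra_simps)
    ultimately consider "p dvd v - y" | "p dvd v + y"
      using prime_dvd_mult_iff[OF p(1)] by auto
    then show ?thesis
    proof cases
      case 1
      then have "[v = y] (mod p)"
        by (simp add: cong_iff_dvd_diff)
      then show ?thesis
        using v y(1) by (auto simp: square_roots_def intro: cong_less_imp_eq_int)
    next
      case 2
      then have "p dvd (v + y) - p"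
        by (intro dvd_diff) simp_all
      then have "[v = p - y] (mod p)"
        by (simp add: cong_iff_dvd_diff algebra_simps)
      moreover have "v \<in> {0..<p}" "p - y \<in> {0..<p}"
        using v y(1) \<open>y \<noteq> 0\<close> by (auto simp: square_roots_def)
      ultimately show ?thesis
        by (auto intro: cong_less_imp_eq_int)
    qed
  qed
  then have "square_roots p c = {y, p - y}"
    using y py \<open>y \<noteq> 0\<close> by (auto simp: square_roots_def)
  moreover have "y \<noteq> p - y"
  proof
    assume "y = p - y"
    then have "p = 2 * y"
      by simp
    then show False
      using p prime_odd_int[of p] by simp
  qed
  ultimately show thesis
    using that by blast
qed

lemma square_roots_eq_zero:
  fixes p c :: int
  assumes p: "prime p" and c: "p dvd c"
  shows "square_roots p c = {0}"
proof -
  have "v = 0" if "v \<in> square_roots p c" for v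
  proof -
    have "[v\<^sup>2 = 0] (mod p)"
      using that c by (simp add: square_roots_def cong_def)
    then have "p dvd v\<^sup>2"
      by (simp only: cong_0_iff)
    then have "p dvd v"
      by (rule prime_dvd_power[OF p])
    then show ?thesis
      using that by (intro residue_dvd_imp_eq_zero) (simp_all add: square_roots_def)
  qed
  moreover have "0 \<in> square_roots p c"
    using p c prime_gt_0_int[of p] by (simp add: square_roots_def cong_0_iff cong_sym_eq[of 0])
  ultimately show ?thesis
    by blast
qed

lemma square_roots_eq_empty:
  fixes p c :: int
  assumes "\<not> p dvd c" and "Legendre c p \<noteq> 1"
  shows "square_roots p c = {}"
  using assms by (auto simp: Legendre_def square_roots_def QuadRes_def cong_0_iff split: if_splits)

lemma card_square_roots:
  fixes p c :: int
  assumes "prime p" "p > 2"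
  shows "card (square_roots p c) = (if Legendre c p = 1 then 2 else 0) + of_bool (p dvd c)"
proof (cases "Legendre c p = 1")
  case True
  then have "\<not> p dvd c"
    by (auto simp: Legendre_def cong_0_iff)
  moreover have "card (square_roots p c) = 2"
    using square_roots_eq_pair[OF assms True] by (metis card_2_iff)
  ultimately show ?thesis
    using True by simp
next
  case False
  then show ?thesis
    using square_roots_eq_zero[OF assms(1)] square_roots_eq_empty by (cases "p dvd c") auto
qed

lemma sum_square_roots:
  fixes p c :: int
  assumes "prime p" "p > 2"
  shows "\<Sum>(square_roots p c) = (if Legendre c p = 1 then p else 0)"
proof (cases "Legendre c p = 1")
  case True
  then obtain y where "square_roots p c = {y, p - y}" "y \<noteq> p - y"
    using square_roots_eq_pair[OF assms] by blast
  then show ?thesis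
    using True by simp
next
  case False
  then show ?thesis
    using square_roots_eq_zero[OF assms(1)] square_roots_eq_empty by (cases "p dvd c") auto
qed

section \<open>Cube roots modulo a prime\<close>

text \<open>
  For every divisor \<open>d\<close> of \<open>p - 1\<close> there are residues of multiplicative order exactly \<open>d\<close>. With
  \<open>d = 3\<close>, such a residue is a root of \<open>w\<^sup>3 - 1 = (w - 1) (w\<^sup>2 + w + 1)\<close> but not of the first factor.
\<close>
lemma primitive_cube_root_of_unity:
  fixes p :: int
  assumes p: "prime p" and mod3: "[p = 1] (mod 3)"
  obtains w where "\<not> p dvd w - 1" and "p dvd w\<^sup>2 + w + 1"
proof -
  define q where "q = nat p"
  have q: "int q = p" "prime q"
    using prime_gt_0_int[OF p] iffD1[OF prime_int_nat_transfer p] unfolding q_def by simp_all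
  have "3 dvd q - 1"
  proof -
    have "int 3 dvd int (q - 1)"
      using mod3 q prime_gt_0_nat[of q] by (simp add: cong_iff_dvd_diff of_nat_diff)
    then show ?thesis
      by (simp only: of_nat_dvd_iff)
  qed
  then have "card {x \<in> totatives q. ord q x = 3} = totient 3"
    using prime_card_elements_with_ord_eq_totient[of q 3] q(2) prime_gt_1_nat[of q] by simp
  then have "card {x \<in> totatives q. ord q x = 3} > 0"
    by simp
  then obtain g where g: "ord q g = 3"
    by (auto simp: card_gt_0_iff)
  have "[g ^ 3 = 1] (mod q)" and "\<not> [g ^ 1 = 1] (mod q)"
    unfolding ord_divides g by simp_all
  then have "[int g ^ 3 = 1] (mod p)" and neq: "\<not> [int g = 1] (mod p)"
    unfolding q(1)[symmetric] by (simp_all flip: cong_int_iff)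
  then have "p dvd int g ^ 3 - 1"
    by (simp add: cong_iff_dvd_diff)
  moreover have "int g ^ 3 - 1 = (int g - 1) * ((int g)\<^sup>2 + int g + 1)"
    by (simp add: power2_eq_square power3_eq_cube algebra_simps)
  moreover have "\<not> p dvd int g - 1"
    using neq by (simp add: cong_iff_dvd_diff)
  ultimately show thesis
    using that prime_dvd_mult_iff[OF p] by auto
qed

text \<open>
  The roots are the residues of \<open>-a e\<close> for the three cube roots of unity \<open>e\<close>; as \<open>a\<close> is invertible,
  they are distinct because \<open>1\<close>, \<open>w\<close> and \<open>w\<^sup>2\<close> are.
\<close>
lemma card_roots_sum_of_cubes:
  fixes p a :: int
  assumes p: "prime p" and mod3: "[p = 1] (mod 3)" and a: "\<not> p dvd a"
  shows "card {x \<in> {0..<p}. p dvd x ^ 3 + a ^ 3} = 3"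
proof -
  obtain w where w1: "\<not> p dvd w - 1" and w2: "p dvd w\<^sup>2 + w + 1"
    using primitive_cube_root_of_unity[OF p mod3] .
  have p0: "p > 0"
    using p by (rule prime_gt_0_int)
  have p_dvd_mult: "p dvd u * v \<longleftrightarrow> p dvd u \<or> p dvd v" for u v
    using p by (rule prime_dvd_mult_iff)
  have w0: "\<not> p dvd w"
  proof
    assume "p dvd w"
    then have "p dvd w\<^sup>2 + w"
      by (simp add: power2_eq_square)
    then have "p dvd 1"
      using w2 by (simp add: dvd_add_right_iff)
    then show False
      using p not_prime_unit by blast
  qed
  define r where "r e = (- (a * e)) mod p" for e
  have r: "p dvd x + a * e \<longleftrightarrow> x = r e" if "x \<in> {0..<p}" for x e
  proof -
    have "p dvd x + a * e \<longleftrightarrow> [x = - (a * e)] (mod p)"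
      by (simp add: cong_iff_dvd_diff)
    also have "\<dots> \<longleftrightarrow> x = r e"
      using that by (auto simp: cong_def r_def)
    finally show ?thesis .
  qed
  have r_inj: "p dvd e - f" if "r e = r f" for e f
  proof -
    have "p dvd - (a * e) - - (a * f)"
      using that unfolding r_def by (simp add: mod_eq_dvd_iff)
    then have "p dvd a * (f - e)"
      by (simp add: algebra_simps)
    then show ?thesis
      using a by (simp add: p_dvd_mult dvd_diff_commute)
  qed
  have "p dvd x ^ 3 + a ^ 3 \<longleftrightarrow> x \<in> {r 1, r w, r (w\<^sup>2)}" if x: "x \<in> {0..<p}" for x
  proof -
    \<comment> \<open>The error term of the factorisation is a multiple of \<open>w\<^sup>2 + w + 1\<close>, as it vanishes for \<open>w\<close> a
      complex primitive cube root of unity.\<close>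
    have "(x + a * 1) * (x + a * w) * (x + a * w\<^sup>2)
        = (x ^ 3 + a ^ 3) + (w\<^sup>2 + w + 1) * (a * x\<^sup>2 + a\<^sup>2 * x * w + a ^ 3 * (w - 1))"
      by (simp add: power2_eq_square power3_eq_cube algebra_simps)
    then have "p dvd x ^ 3 + a ^ 3 \<longleftrightarrow> p dvd (x + a * 1) * (x + a * w) * (x + a * w\<^sup>2)"
      using w2 by (simp only: dvd_add_left_iff dvd_mult2)
    then show ?thesis
      using r[OF x] by (simp only: p_dvd_mult) auto
  qed
  moreover have "r e \<in> {0..<p}" for e
    using p0 by (simp add: r_def)
  ultimately have "{x \<in> {0..<p}. p dvd x ^ 3 + a ^ 3} = {r 1, r w, r (w\<^sup>2)}"
    by blast
  moreover have "r 1 \<noteq> r w"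
    using r_inj[of w 1] w1 by auto
  moreover have "r w \<noteq> r (w\<^sup>2)"
  proof
    assume "r w = r (w\<^sup>2)"
    then have "p dvd w * (w - 1)"
      using r_inj[of "w\<^sup>2" w] by (simp add: power2_eq_square algebra_simps)
    then show False
      using w0 w1 by (simp add: p_dvd_mult)
  qed
  moreover have "r 1 \<noteq> r (w\<^sup>2)"
  proof
    assume "r 1 = r (w\<^sup>2)"
    then have "p dvd (w - 1) * (w + 1)"
      using r_inj[of "w\<^sup>2" 1] by (simp add: power2_eq_square algebra_simps)
    then have "p dvd w + 1"
      using w1 by (simp add: p_dvd_mult)
    \<comment> \<open>Then \<open>w\<^sup>2 = (w\<^sup>2 + w + 1) - (w + 1)\<close> would vanish.\<close>
    then have "p dvd w * w"
      using w2 by (simp add: power2_eq_square add.assoc dvd_add_left_iff)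
    then show False
      using w0 by (simp add: p_dvd_mult)
  qed
  ultimately show ?thesis
    by simp
qed

section \<open>Counting points and summing ordinates\<close>

theorem theorem2:
  fixes p a :: int
  assumes "prime p" and "[p = 1] (mod 6)" and "\<not> p dvd a"
  shows "card (curve_points p a) = 4 + (\<Sum>x\<in>{0..<p}. rho p a x)
    \<and> (\<forall>x\<in>{0..<p}. Legendre (x^3 + a^3) p = 1 \<longrightarrow>
          (\<Sum>y | Affine x y \<in> curve_points p a. y) = p)
    \<and> [(\<Sum>(x, y) | Affine x y \<in> curve_points p a. y) = p] (mod p)"
proof -
  define column where "column x = square_roots p (x ^ 3 + a ^ 3)" for x
  define S where "S = Sigma {0..<p} column"
  have p2: "p > 2"
    using assms(2) prime_ge_2_int[OF assms(1)] by (cases "p = 2") (auto simp: cong_def)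
  have "[p = 1] (mod 3)"
    using assms(2) by (rule cong_dvd_modulus) simp
  then have card_roots: "card {x \<in> {0..<p}. p dvd x ^ 3 + a ^ 3} = 3"
    using card_roots_sum_of_cubes assms by blast
  have affine: "Affine x y \<in> curve_points p a \<longleftrightarrow> (x, y) \<in> S" for x y
    by (auto simp: curve_points_def S_def column_def square_roots_def)
  have fin: "finite (column x)" for x
    by (simp add: column_def)

  have "curve_points p a = insert Infinity ((\<lambda>(x, y). Affine x y) ` S)"
    by (auto simp: curve_points_def S_def column_def square_roots_def)
  moreover have "inj_on (\<lambda>(x, y). Affine x y) S"
    by (auto simp: inj_on_def)
  moreover have "finite S"
    by (simp add: S_def fin)
  ultimately have "card (curve_points p a) = Suc (card S)"
    by (auto simp: card_image card_insert_if)
  also have "card S = (\<Sum>x\<in>{0..<p}. card (column x))"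
    unfolding S_def by (simp add: fin)
  also have "\<dots> = (\<Sum>x\<in>{0..<p}. rho p a x + of_bool (p dvd x ^ 3 + a ^ 3))"
    by (simp add: column_def card_square_roots[OF assms(1) p2] rho_def)
  also have "\<dots> = (\<Sum>x\<in>{0..<p}. rho p a x) + 3"
    using card_roots by (simp add: sum.distrib Int_def)
  finally have count: "card (curve_points p a) = 4 + (\<Sum>x\<in>{0..<p}. rho p a x)"
    by simp

  have "(\<Sum>y | Affine x y \<in> curve_points p a. y) = p"
    if "x \<in> {0..<p}" "Legendre (x ^ 3 + a ^ 3) p = 1" for x
  proof -
    have "{y. Affine x y \<in> curve_points p a} = column x"
      using that(1) by (auto simp: affine S_def)
    then show ?thesis
      using that(2) by (simp add: column_def sum_square_roots[OF assms(1) p2])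
  qed
  moreover have "[(\<Sum>(x, y) | Affine x y \<in> curve_points p a. y) = p] (mod p)"
  proof -
    have "(\<Sum>(x, y) | Affine x y \<in> curve_points p a. y) = (\<Sum>(x, y)\<in>S. y)"
      by (simp add: affine)
    also have "\<dots> = (\<Sum>x\<in>{0..<p}. \<Sum>(column x))"
      unfolding S_def by (simp add: sum.Sigma fin)
    finally have "(\<Sum>(x, y) | Affine x y \<in> curve_points p a. y) = (\<Sum>x\<in>{0..<p}. \<Sum>(column x))" .
    moreover have "p dvd (\<Sum>x\<in>{0..<p}. \<Sum>(column x))"
      unfolding column_def sum_square_roots[OF assms(1) p2] by (intro dvd_sum) simp
    ultimately show ?thesis
      by (simp add: cong_iff_dvd_diff)
  qed
  ultimately show ?thesis
    using count by blast
qed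

end
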